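(* Consider a sigmoid network problem $\min_{\theta\in\mathbb{R}^n}\mathbb{L}(F(\theta))$ with the quadratic, absolute, or hinge loss function (see context). Let $\{\theta_k\}$ be a sequence generated by the linearized proximal algorithm (LPA) with parameter $t>0$ and initial point $\theta_0$, and let $\bar\theta\in\mathbb{R}^n$ be such that $F(\bar\theta)\in C_{\mathbb{L}}$. If $F'(\bar\theta)$ has full row rank, then there exists an $\bar r>0$ such that for any initial point $\theta_0\in B(\bar\theta,\bar r)$, we have: (i) for the sigmoid networks with the quadratic loss function, the sequence $\{\theta_k\}$ linearly converges to a globally optimal solution $\theta^*$ and $F(\theta^* )=0$, if $t$ is sufficiently large; (ii) for the sigmoid networks with the absolute loss function, the sequence $\{\theta_k\}$ quadratically converges to a globally optimal solution $\theta^*$ and $F(\theta^* )=0$; (iii) for the sigmoid networks with the hinge loss function, the sequence $\{\theta_k\}$ quadratically converges to a globally optimal solution $\theta^*$ and $F(\theta^* )\ge\mathbf{1}$ (componentwise, $\mathbf 1=(1,\dots,1)$).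
   Context: **Sigmoid network.** Let $\sigma(a)=1/(1+e^{-a})$. For parameters $\theta=(w_1,\dots,w_q,v_1,\dots,v_q,u_1,\dots,u_q,w_0)\in\mathbb{R}^n$, where $w_i,u_i,w_0\in\mathbb{R}$, $v_i\in\mathbb{R}^d$ and $n=(d+2)q+1$, set $f(x;\theta)=\sum_{i=1}^q w_i\,\sigma(v_i\cdot x+u_i)+w_0$ for $x\in\mathbb{R}^d$. Training data $(x_i,y_i)\in\mathbb{R}^d\times\mathbb{R}$, $i=1,\dots,m$, are given. **Inner and outer functions $F:\mathbb{R}^n\to\mathbb{R}^m$, $\mathbb{L}:\mathbb{R}^m\to\mathbb{R}$.** - Quadratic loss: $F(\theta)=(f(x_i;\theta)-y_i)_{i=1}^m$, $\mathbb{L}(z)=\frac1m\|z\|^2$. - Absolute loss: $F(\theta)=(f(x_i;\theta)-y_i)_{i=1}^m$, $\mathbb{L}(z)=\frac1m\|z\|_1$. - Hinge loss: $F(\theta)=(y_if(x_i;\theta))_{i=1}^m$, $\mathbb{L}(z)=\frac1m\sum_{i=1}^m\max(1-z_i,0)$. $F'(\theta)\in\mathbb{R}^{m\times n}$ is the Jacobian matrix of $F$; $C_{\mathbb{L}}=\arg\min_{z\in\mathbb{R}^m}\mathbb{L}(z)$; $\|\cdot\|$ is the Euclidean norm; $B(z,r)$ is the open ball of radius $r$ centered at $z$. A globally optimal solution is a global minimizer of $\theta\mapsto\mathbb{L}(F(\theta))$ on $\mathbb{R}^n$. **LPA.** Given $t>0$ and $\theta_0\in\mathbb{R}^n$, for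 $k=0,1,2,\dots$ let $$\Delta\theta_k=\arg\min_{\Delta\theta\in\mathbb{R}^n}\Big\{\mathbb{L}(F(\theta_k)+F'(\theta_k)\Delta\theta)+\tfrac1{2t}\|\Delta\theta\|^2\Big\};$$ set $\theta_{k+1}=\theta_k+\Delta\theta_k$, and stop if $\Delta\theta_k=0$. *)

theory Defs
  imports "HOL-Analysis.Analysis"
begin

text \<open>
  The parameter space \<open>\<real>\<^sup>n\<close> with \<open>n = (d + 2) q + 1\<close>: the finite index type is the disjoint union of
  the indices of the \<open>w\<^sub>i\<close>, of the components of the \<open>v\<^sub>i\<close>, of the \<open>u\<^sub>i\<close>, and of the single
  index of \<open>w\<^sub>0\<close>. The type \<open>'q\<close> enumerates the neurons, \<open>'d\<close> the input coordinates and \<open>'m\<close> the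
  training samples.
\<close>

type_synonym ('q, 'd) params = "real ^ ('q + 'q \<times> 'd + 'q + unit)"

lemma card_params:
  "CARD('q::finite + 'q \<times> 'd::finite + 'q + unit) = (CARD('d) + 2) * CARD('q) + 1"
  by (simp add: card_UNIV_sum algebra_simps)

definition outer_weight :: "('q::finite, 'd::finite) params \<Rightarrow> 'q \<Rightarrow> real" where
  "outer_weight \<theta> i = \<theta> $ Inl i"

definition inner_weight :: "('q::finite, 'd::finite) params \<Rightarrow> 'q \<Rightarrow> real ^ 'd" where
  "inner_weight \<theta> i = (\<chi> j. \<theta> $ Inr (Inl (i, j)))"

definition inner_bias :: "('q::finite, 'd::finite) params \<Rightarrow> 'q \<Rightarrow> real" where
  "inner_bias \<theta> i = \<theta> $ Inr (Inr (Inl i))"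

definition outer_bias :: "('q::finite, 'd::finite) params \<Rightarrow> real" where
  "outer_bias \<theta> = \<theta> $ Inr (Inr (Inr ()))"

definition sigmoid :: "real \<Rightarrow> real" where
  "sigmoid a = 1 / (1 + exp (- a))"

definition network :: "real ^ 'd \<Rightarrow> ('q::finite, 'd::finite) params \<Rightarrow> real" where
  "network x \<theta> =
     (\<Sum>i\<in>UNIV. outer_weight \<theta> i * sigmoid (inner_weight \<theta> i \<bullet> x + inner_bias \<theta> i)) + outer_bias \<theta>"

definition residual_map ::
  "('m \<Rightarrow> real ^ 'd) \<Rightarrow> ('m \<Rightarrow> real) \<Rightarrow> ('q::finite, 'd::finite) params \<Rightarrow> real ^ 'm::finite" where
  "residual_map x y \<theta> = (\<chi> i. network (x i) \<theta> - y i)"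

definition margin_map ::
  "('m \<Rightarrow> real ^ 'd) \<Rightarrow> ('m \<Rightarrow> real) \<Rightarrow> ('q::finite, 'd::finite) params \<Rightarrow> real ^ 'm::finite" where
  "margin_map x y \<theta> = (\<chi> i. y i * network (x i) \<theta>)"

definition quadratic_loss :: "real ^ 'm::finite \<Rightarrow> real" where
  "quadratic_loss z = 1 / real CARD('m) * (norm z)\<^sup>2"

definition absolute_loss :: "real ^ 'm::finite \<Rightarrow> real" where
  "absolute_loss z = 1 / real CARD('m) * (\<Sum>i\<in>UNIV. \<bar>z $ i\<bar>)"

definition hinge_loss :: "real ^ 'm::finite \<Rightarrow> real" where
  "hinge_loss z = 1 / real CARD('m) * (\<Sum>i\<in>UNIV. max (1 - z $ i) 0)"

definition minimizers :: "('a \<Rightarrow> real) \<Rightarrow> 'a set" where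
  "minimizers g = {z. is_arg_min g (\<lambda>_. True) z}"

definition full_row_rank :: "real ^ 'n ^ 'm::finite \<Rightarrow> bool" where
  "full_row_rank A \<longleftrightarrow> rank A = CARD('m)"

definition lpa_direction ::
  "(real ^ 'm \<Rightarrow> real) \<Rightarrow> (real ^ 'n \<Rightarrow> real ^ 'm) \<Rightarrow> real \<Rightarrow> real ^ 'n \<Rightarrow> real ^ 'n" where
  "lpa_direction L F t \<theta> =
     arg_min (\<lambda>\<delta>. L (F \<theta> + jacobian F (at \<theta>) *v \<delta>) + 1 / (2 * t) * (norm \<delta>)\<^sup>2) (\<lambda>_. True)"

text \<open>
  A run that stops, i.e. reaches a zero direction, is represented by the sequence that stays constant
  from there on; the recursion below does this by itself, since the direction only depends on the
  current iterate.
\<close>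

primrec lpa ::
  "(real ^ 'm \<Rightarrow> real) \<Rightarrow> (real ^ 'n \<Rightarrow> real ^ 'm) \<Rightarrow> real \<Rightarrow> real ^ 'n \<Rightarrow> nat \<Rightarrow> real ^ 'n" where
  "lpa L F t \<theta>\<^sub>0 0 = \<theta>\<^sub>0"
| "lpa L F t \<theta>\<^sub>0 (Suc k) = lpa L F t \<theta>\<^sub>0 k + lpa_direction L F t (lpa L F t \<theta>\<^sub>0 k)"

text \<open>Q-linear and Q-quadratic convergence, in product form so that iterates may hit the limit.\<close>

definition linearly_converges :: "(nat \<Rightarrow> 'a::metric_space) \<Rightarrow> 'a \<Rightarrow> bool" where
  "linearly_converges X l \<longleftrightarrow>
     X \<longlonglongrightarrow> l \<and>
     (\<exists>c. 0 < c \<and> c < 1 \<and> (\<forall>\<^sub>F k in sequentially. dist (X (Suc k)) l \<le> c * dist (X k) l))"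

definition quadratically_converges :: "(nat \<Rightarrow> 'a::metric_space) \<Rightarrow> 'a \<Rightarrow> bool" where
  "quadratically_converges X l \<longleftrightarrow>
     X \<longlonglongrightarrow> l \<and>
     (\<exists>C>0. \<forall>\<^sub>F k in sequentially. dist (X (Suc k)) l \<le> C * (dist (X k) l)\<^sup>2)"

end

theory Submission
  imports Defs
begin

text \<open>
  Write \<open>C\<close> for the minimizers of the loss and \<open>e \<theta>\<close> for the distance of \<open>F \<theta>\<close> from \<open>C\<close>. By full row
  rank the Jacobian matrices near \<open>\<theta>b\<close> have uniformly bounded right inverses, so the linear model can
  be moved into \<open>C\<close> at a cost of order \<open>e \<theta>\<close>; comparing with that move, the direction \<open>\<Delta>\<close> satisfies
  \<open>\<parallel>\<Delta>\<parallel> \<le> \<kappa> e \<theta>\<close>. As \<open>F\<close> has a Lipschitz derivative, \<open>e (\<theta> + \<Delta>)\<close> exceeds the distance of the model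
  value from \<open>C\<close> by at most a multiple of \<open>(e \<theta>)\<^sup>2\<close>. For the quadratic loss that distance is at most
  \<open>\<epsilon> e \<theta>\<close> once \<open>t\<close> is large. The absolute and the hinge loss grow linearly away from \<open>C\<close>, which makes
  the penalty exact: near \<open>\<theta>b\<close> the model value lies in \<open>C\<close>, whatever \<open>t\<close> is. So \<open>e\<close> contracts, linearly
  or quadratically, along the iterates; the iterates converge, and their distance from the limit is
  comparable with \<open>e\<close>.
\<close>

section \<open>Functions with bounded Lipschitz gradient\<close>

text \<open>A product of Lipschitz functions is again Lipschitz once the factors are bounded, so the
  class asks for both. A single constant \<open>B\<close> serves as bound and as Lipschitz
  constant.\<close>

definition bounded_lipschitz_on :: "'a::metric_space set \<Rightarrow> ('a \<Rightarrow> 'b::real_normed_vector) \<Rightarrow> bool" where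
  "bounded_lipschitz_on S f \<longleftrightarrow>
     (\<exists>B\<ge>0. \<forall>u\<in>S. norm (f u) \<le> B \<and> (\<forall>v\<in>S. norm (f u - f v) \<le> B * dist u v))"

lemma bounded_lipschitz_on_const: "bounded_lipschitz_on S (\<lambda>_. c)"
  unfolding bounded_lipschitz_on_def by (rule exI[of _ "norm c"]) auto

lemma bounded_lipschitz_on_add:
  assumes "bounded_lipschitz_on S f" "bounded_lipschitz_on S g"
  shows "bounded_lipschitz_on S (\<lambda>u. f u + g u)"
proof -
  obtain A where A: "A \<ge> 0" "\<And>u. u \<in> S \<Longrightarrow> norm (f u) \<le> A"
    "\<And>u v. u \<in> S \<Longrightarrow> v \<in> S \<Longrightarrow> norm (f u - f v) \<le> A * dist u v"
    using assms(1) unfolding bounded_lipschitz_on_def by blast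
  obtain B where B: "B \<ge> 0" "\<And>u. u \<in> S \<Longrightarrow> norm (g u) \<le> B"
    "\<And>u v. u \<in> S \<Longrightarrow> v \<in> S \<Longrightarrow> norm (g u - g v) \<le> B * dist u v"
    using assms(2) unfolding bounded_lipschitz_on_def by blast
  have "norm (f u + g u) \<le> A + B" if "u \<in> S" for u
    using norm_triangle_mono A(2) B(2) that by blast
  moreover have "norm (f u + g u - (f v + g v)) \<le> (A + B) * dist u v" if "u \<in> S" "v \<in> S" for u v
    unfolding add_diff_add distrib_right
    by (intro norm_triangle_mono A(3) B(3) that)
  ultimately show ?thesis
    unfolding bounded_lipschitz_on_def using A(1) B(1)
    by (intro exI[of _ "A + B"]) auto
qed

text \<open>Inserting \<open>f u *\<^sub>R g v\<close> splits the difference into two terms, each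
  the bound of one factor times the variation of the other. The form with \<open>scaleR\<close>
  covers real products and function values times gradients alike.\<close>

lemma bounded_lipschitz_on_scaleR:
  fixes f :: "'a::metric_space \<Rightarrow> real"
  assumes "bounded_lipschitz_on S f" "bounded_lipschitz_on S g"
  shows "bounded_lipschitz_on S (\<lambda>u. f u *\<^sub>R g u)"
proof -
  obtain A where A: "A \<ge> 0" "\<And>u. u \<in> S \<Longrightarrow> norm (f u) \<le> A"
    "\<And>u v. u \<in> S \<Longrightarrow> v \<in> S \<Longrightarrow> norm (f u - f v) \<le> A * dist u v"
    using assms(1) unfolding bounded_lipschitz_on_def by blast
  obtain B where B: "B \<ge> 0" "\<And>u. u \<in> S \<Longrightarrow> norm (g u) \<le> B"
    "\<And>u v. u \<in> S \<Longrightarrow> v \<in> S \<Longrightarrow> norm (g u - g v) \<le> B * dist u v"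
    using assms(2) unfolding bounded_lipschitz_on_def by blast
  have bd: "norm (f u *\<^sub>R g u) \<le> A * B" if "u \<in> S" for u
    unfolding norm_scaleR using A(1) A(2)[OF that] B(2)[OF that]
    by (intro mult_mono) (auto simp: real_norm_def)
  have lip: "norm (f u *\<^sub>R g u - f v *\<^sub>R g v) \<le> (2 * A * B) * dist u v" if "u \<in> S" "v \<in> S" for u v
  proof -
    have "f u *\<^sub>R g u - f v *\<^sub>R g v = f u *\<^sub>R (g u - g v) + (f u - f v) *\<^sub>R g v"
      by (simp add: algebra_simps)
    also have "norm \<dots> \<le> A * (B * dist u v) + (A * dist u v) * B"
      using A(1) A(2)[OF that(1)] A(3)[OF that] B(2)[OF that(2)] B(3)[OF that]
      by (intro norm_triangle_mono; unfold norm_scaleR; intro mult_mono)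
        (auto simp: real_norm_def)
    finally show ?thesis by (simp add: algebra_simps)
  qed
  show ?thesis
    unfolding bounded_lipschitz_on_def
  proof (intro exI[of _ "2 * A * B"] conjI ballI)
    show "norm (f u *\<^sub>R g u) \<le> 2 * A * B" if "u \<in> S" for u
      using bd[OF that] mult_nonneg_nonneg[OF A(1) B(1)] by linarith
  qed (use A(1) B(1) lip in auto)
qed

lemma bounded_lipschitz_on_compose:
  assumes "bounded_lipschitz_on S f" "bounded_lipschitz_on UNIV \<phi>"
  shows "bounded_lipschitz_on S (\<lambda>u. \<phi> (f u))"
proof -
  obtain A where A: "A \<ge> 0"
    "\<And>u v. u \<in> S \<Longrightarrow> v \<in> S \<Longrightarrow> norm (f u - f v) \<le> A * dist u v"
    using assms(1) unfolding bounded_lipschitz_on_def by blast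
  obtain B where B: "B \<ge> 0" "\<And>a. norm (\<phi> a) \<le> B" "\<And>a b. norm (\<phi> a - \<phi> b) \<le> B * dist a b"
    using assms(2) unfolding bounded_lipschitz_on_def by blast
  \<comment> \<open>The composite has Lipschitz constant \<open>A * B\<close> and bound
    \<open>B\<close>; the sum dominates both.\<close>
  have "norm (\<phi> (f u) - \<phi> (f v)) \<le> (A * B + B) * dist u v" if "u \<in> S" "v \<in> S" for u v
  proof -
    have "norm (\<phi> (f u) - \<phi> (f v)) \<le> B * norm (f u - f v)"
      using B(3)[of "f u" "f v"] by (simp add: dist_norm)
    also have "\<dots> \<le> B * (A * dist u v)"
      by (intro mult_left_mono A(2) that B(1))
    also have "\<dots> \<le> (A * B + B) * dist u v"
      using B(1) by (simp add: algebra_simps)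
    finally show ?thesis .
  qed
  moreover have "norm (\<phi> a) \<le> A * B + B" for a
    using B(2)[of a] mult_nonneg_nonneg[OF A(1) B(1)] by linarith
  ultimately show ?thesis
    unfolding bounded_lipschitz_on_def using A(1) B(1) by (intro exI[of _ "A * B + B"]) auto
qed

text \<open>The gradient is a vector field \<open>g\<close> under the same condition as
  \<open>f\<close>, so that the product rule does not lead out of the class.\<close>

definition c11_on :: "'a::real_inner set \<Rightarrow> ('a \<Rightarrow> real) \<Rightarrow> bool" where
  "c11_on S f \<longleftrightarrow> bounded_lipschitz_on S f \<and>
     (\<exists>g. bounded_lipschitz_on S g \<and> (\<forall>u\<in>S. (f has_derivative (\<lambda>h. g u \<bullet> h)) (at u)))"

lemma c11_onE:
  assumes "c11_on S f"
  obtains g where "bounded_lipschitz_on S f" "bounded_lipschitz_on S g"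
    "\<And>u. u \<in> S \<Longrightarrow> (f has_derivative (\<lambda>h. g u \<bullet> h)) (at u)"
  using assms unfolding c11_on_def by blast

lemma c11_on_const: "c11_on S (\<lambda>_. c)"
proof -
  have "((\<lambda>_. c) has_derivative (\<lambda>h. 0 \<bullet> h)) (at u)" for u :: 'a
    unfolding inner_zero_left by (rule has_derivative_const)
  then show ?thesis
    unfolding c11_on_def
    by (intro conjI exI[of _ "\<lambda>_. 0"] ballI bounded_lipschitz_on_const)
qed

lemma c11_on_add:
  assumes "c11_on S f1" "c11_on S f2"
  shows "c11_on S (\<lambda>u. f1 u + f2 u)"
proof -
  obtain g1 where 1: "bounded_lipschitz_on S f1" "bounded_lipschitz_on S g1"
    "\<And>u. u \<in> S \<Longrightarrow> (f1 has_derivative (\<lambda>h. g1 u \<bullet> h)) (at u)"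
    using assms(1) by (rule c11_onE) blast
  obtain g2 where 2: "bounded_lipschitz_on S f2" "bounded_lipschitz_on S g2"
    "\<And>u. u \<in> S \<Longrightarrow> (f2 has_derivative (\<lambda>h. g2 u \<bullet> h)) (at u)"
    using assms(2) by (rule c11_onE) blast
  have "((\<lambda>u. f1 u + f2 u) has_derivative (\<lambda>h. (g1 u + g2 u) \<bullet> h)) (at u)" if "u \<in> S" for u
    unfolding inner_add_left by (rule has_derivative_add[OF 1(3)[OF that] 2(3)[OF that]])
  then show ?thesis
    unfolding c11_on_def
    using bounded_lipschitz_on_add[OF 1(1) 2(1)] bounded_lipschitz_on_add[OF 1(2) 2(2)] by blast
qed

lemma c11_on_mult:
  assumes "c11_on S f1" "c11_on S f2"
  shows "c11_on S (\<lambda>u. f1 u * f2 u)"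
proof -
  obtain g1 where 1: "bounded_lipschitz_on S f1" "bounded_lipschitz_on S g1"
    "\<And>u. u \<in> S \<Longrightarrow> (f1 has_derivative (\<lambda>h. g1 u \<bullet> h)) (at u)"
    using assms(1) by (rule c11_onE) blast
  obtain g2 where 2: "bounded_lipschitz_on S f2" "bounded_lipschitz_on S g2"
    "\<And>u. u \<in> S \<Longrightarrow> (f2 has_derivative (\<lambda>h. g2 u \<bullet> h)) (at u)"
    using assms(2) by (rule c11_onE) blast
  define g where "g u = f1 u *\<^sub>R g2 u + f2 u *\<^sub>R g1 u" for u
  have "bounded_lipschitz_on S g"
    unfolding g_def by (intro bounded_lipschitz_on_add bounded_lipschitz_on_scaleR 1 2)
  moreover have "((\<lambda>u. f1 u * f2 u) has_derivative (\<lambda>h. g u \<bullet> h)) (at u)" if "u \<in> S" for u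
    unfolding g_def using 1(3)[OF that] 2(3)[OF that]
    by (auto intro!: derivative_eq_intros simp: inner_add_left)
  moreover have "bounded_lipschitz_on S (\<lambda>u. f1 u * f2 u)"
    using bounded_lipschitz_on_scaleR[OF 1(1) 2(1)] by simp
  ultimately show ?thesis
    unfolding c11_on_def by blast
qed

lemma c11_on_sum:
  assumes "\<And>i. i \<in> I \<Longrightarrow> c11_on S (f i)"
  shows "c11_on S (\<lambda>u. \<Sum>i\<in>I. f i u)"
  using assms
  by (induction I rule: infinite_finite_induct) (auto intro: c11_on_const c11_on_add)

text \<open>Coordinates are Lipschitz everywhere with constant 1, but bounded only on bounded sets;
  \<open>max B 1\<close> covers both requirements.\<close>

lemma c11_on_nth:
  fixes S :: "(real ^ 'n) set"
  assumes "bounded S"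
  shows "c11_on S (\<lambda>u. u $ i)"
proof -
  obtain B where B: "\<And>u. u \<in> S \<Longrightarrow> norm u \<le> B"
    using assms unfolding bounded_iff by blast
  have "norm (u $ i) \<le> max B 1" if "u \<in> S" for u
    using component_le_norm_cart[of u i] B[OF that] by simp
  moreover have "norm (u $ i - v $ i) \<le> max B 1 * dist u v" for u v :: "real ^ 'n"
  proof -
    have "norm (u $ i - v $ i) \<le> 1 * dist u v"
      using component_le_norm_cart[of "u - v" i] by (simp add: dist_norm)
    also have "\<dots> \<le> max B 1 * dist u v"
      by (intro mult_right_mono) auto
    finally show ?thesis .
  qed
  ultimately have "bounded_lipschitz_on S (\<lambda>u. u $ i)"
    unfolding bounded_lipschitz_on_def by (intro exI[of _ "max B 1"]) auto
  moreover have "((\<lambda>u. u $ i) has_derivative (\<lambda>h. axis i 1 \<bullet> h)) (at u)" for u :: "real ^ 'n"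
    unfolding inner_axis' by (auto intro!: bounded_linear_imp_has_derivative)
  ultimately show ?thesis
    unfolding c11_on_def using bounded_lipschitz_on_const by blast
qed

section \<open>The sigmoid function and the network\<close>

lemma sigmoid_bounds: "0 \<le> sigmoid a" "sigmoid a \<le> 1"
  unfolding sigmoid_def by (simp_all add: add_nonneg_nonneg divide_le_eq_1 add_pos_pos)

lemma sigmoid_has_real_derivative:
  "(sigmoid has_real_derivative sigmoid a * (1 - sigmoid a)) (at a)"
proof -
  have "1 + exp (- a) \<noteq> 0"
    by (metis add_pos_pos exp_gt_zero less_irrefl zero_less_one)
  then show ?thesis
    unfolding sigmoid_def [abs_def]
    by (auto intro!: derivative_eq_intros simp: field_simps power2_eq_square)
qed

text \<open>The derivative \<open>sigmoid z * (1 - sigmoid z)\<close> has absolute value at most 1,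
  so the mean value inequality gives the Lipschitz constant 1.\<close>

lemma bounded_lipschitz_on_sigmoid: "bounded_lipschitz_on UNIV sigmoid"
proof -
  have "norm (sigmoid a - sigmoid b) \<le> 1 * norm (a - b)" for a b
  proof (rule field_differentiable_bound[of UNIV])
    show "norm (sigmoid z * (1 - sigmoid z)) \<le> 1" for z
      using sigmoid_bounds[of z] mult_le_one[of "sigmoid z" "1 - sigmoid z"] by (simp add: abs_mult)
  qed (auto intro: sigmoid_has_real_derivative)
  then show ?thesis
    unfolding bounded_lipschitz_on_def using sigmoid_bounds
    by (intro exI[of _ 1]) (auto simp: dist_norm)
qed

text \<open>The derivative of the sigmoid is a polynomial in the sigmoid itself. Hence the gradient
  of the composite, s (1 - s) g, is covered by the closure rules for sums and multiples.\<close>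

lemma c11_on_sigmoid:
  assumes "c11_on S f"
  shows "c11_on S (\<lambda>u. sigmoid (f u))"
proof -
  obtain g where g: "bounded_lipschitz_on S f" "bounded_lipschitz_on S g"
    "\<And>u. u \<in> S \<Longrightarrow> (f has_derivative (\<lambda>h. g u \<bullet> h)) (at u)"
    using assms by (rule c11_onE) blast
  define s where "s u = sigmoid (f u)" for u
  have s: "bounded_lipschitz_on S s"
    unfolding s_def by (rule bounded_lipschitz_on_compose[OF g(1) bounded_lipschitz_on_sigmoid])
  have "bounded_lipschitz_on S (\<lambda>u. s u *\<^sub>R (g u + (- 1) *\<^sub>R (s u *\<^sub>R g u)))"
    by (intro bounded_lipschitz_on_scaleR bounded_lipschitz_on_add bounded_lipschitz_on_const s g)
  moreover have "(s has_derivative (\<lambda>h. (s u *\<^sub>R (g u + (- 1) *\<^sub>R (s u *\<^sub>R g u))) \<bullet> h)) (at u)"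
    if "u \<in> S" for u
    using has_derivative_compose[OF g(3)[OF that]
        sigmoid_has_real_derivative[THEN has_field_derivative_imp_has_derivative]]
    by (simp add: s_def [abs_def] inner_diff_left algebra_simps)
  ultimately show ?thesis
    unfolding c11_on_def s_def [symmetric, abs_def] using s by blast
qed

text \<open>As a function of the parameters the network consists of coordinates, constants, sums,
  products and sigmoids; expanding the inner product into coordinates exposes this
  structure.\<close>

lemma c11_on_network:
  fixes S :: "('q::finite, 'd::finite) params set"
  assumes "bounded S"
  shows "c11_on S (network x)"
  unfolding network_def [abs_def] outer_weight_def inner_weight_def inner_bias_def outer_bias_def
    inner_vec_def
  by (simp, intro c11_on_add c11_on_sum c11_on_mult c11_on_sigmoid c11_on_nth c11_on_const assms)

section \<open>Maps that are regular at a point\<close>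

text \<open>The right inverse \<open>B\<close> of \<open>A\<close> nearly inverts \<open>J\<close>: the map \<open>J B\<close> is injective, hence onto.\<close>

lemma right_inverse_perturbation:
  fixes A :: "real ^ 'n ^ 'm"
  assumes "surj ((*v) A)"
  obtains \<kappa> \<epsilon> where "\<kappa> > 0" "\<epsilon> > 0"
    "\<And>J z. (\<And>h. norm (J *v h - A *v h) \<le> \<epsilon> * norm h) \<Longrightarrow> \<exists>h. J *v h = z \<and> norm h \<le> \<kappa> * norm z"
proof -
  obtain B where B: "A ** B = mat 1"
    using assms matrix_right_invertible_surjective[of A] by blast
  obtain \<beta> where \<beta>: "\<beta> > 0" "\<And>w. norm (B *v w) \<le> norm w * \<beta>"
    using bounded_linear.pos_bounded[OF matrix_vector_mul_bounded_linear[of B]] by blast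
  have key: "\<exists>h. J *v h = z \<and> norm h \<le> (2 * \<beta>) * norm z"
    if J: "\<And>h. norm (J *v h - A *v h) \<le> 1 / (2 * \<beta>) * norm h" for J :: "real ^ 'n ^ 'm" and z
  proof -
    \<comment> \<open>Since \<open>B *v w\<close> has norm at most \<beta> times that of
      \<open>w\<close>, the tolerance lets \<open>J ** B\<close> move \<open>w\<close> by at most
      half its norm. This gives injectivity and, with the bound on \<open>B\<close>, the constant
      \<open>2 * \<beta>\<close>.\<close>
    have low: "norm w \<le> 2 * norm (J *v (B *v w))" for w
    proof -
      have w: "A *v (B *v w) = w"
        by (simp add: matrix_vector_mul_assoc B)
      have "norm (J *v (B *v w) - w) \<le> 1 / (2 * \<beta>) * norm (B *v w)"
        using J[of "B *v w"] by (simp add: w)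
      also have "\<dots> \<le> 1 / (2 * \<beta>) * (norm w * \<beta>)"
        using \<beta> by (intro mult_left_mono) auto
      also have "\<dots> = norm w / 2"
        using \<beta>(1) by simp
      finally show ?thesis
        using norm_triangle_ineq2[of w "w - J *v (B *v w)"] by (simp add: norm_minus_commute)
    qed
    have lin: "linear (\<lambda>w. J *v (B *v w))"
      by (simp add: matrix_vector_mul_assoc)
    have "inj (\<lambda>w. J *v (B *v w))"
      unfolding linear_injective_0[OF lin]
    proof (intro allI impI)
      show "w = 0" if "J *v (B *v w) = 0" for w
        using low[of w] that by simp
    qed
    then have "surj (\<lambda>w. J *v (B *v w))"
      using lin by (simp add: linear_injective_imp_surjective)
    then obtain w where w: "J *v (B *v w) = z"
      by (metis surjD)
    have "norm (B *v w) \<le> (2 * norm z) * \<beta>"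
      using \<beta> low[of w] w by (meson less_imp_le mult_right_mono order_trans)
    then show ?thesis
      using w by (intro exI[of _ "B *v w"]) (simp add: algebra_simps)
  qed
  show thesis
    by (rule that[of "2 * \<beta>" "1 / (2 * \<beta>)"]) (use \<beta>(1) key in auto)
qed

text \<open>\<open>K\<close>, \<open>M\<close> and \<open>\<kappa>\<close> bound, on the ball, the error of the linearization, the Lipschitz constant, and
  a right inverse of the Jacobian matrix.\<close>

definition regular_near ::
  "(real ^ 'n \<Rightarrow> real ^ 'm) \<Rightarrow> real ^ 'n \<Rightarrow> real \<Rightarrow> real \<Rightarrow> real \<Rightarrow> real \<Rightarrow> bool" where
  "regular_near F b R K M \<kappa> \<longleftrightarrow> R > 0 \<and> K > 0 \<and> M > 0 \<and> \<kappa> > 0 \<and>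
     (\<forall>u\<in>ball b R.
       (\<forall>v\<in>ball b R. norm (F v - F u - jacobian F (at u) *v (v - u)) \<le> K * (norm (v - u))\<^sup>2 \<and>
          norm (F v - F u) \<le> M * norm (v - u)) \<and>
       (\<forall>z. \<exists>h. jacobian F (at u) *v h = z \<and> norm h \<le> \<kappa> * norm z))"

text \<open>Bounds on the components add up to bounds on vectors, because the Euclidean norm is at
  most the sum of the absolute components. The Jacobian matrix is then Lipschitz, which controls the
  linearization error and carries surjectivity from \<open>b\<close> to a ball around it.\<close>

lemma regular_nearI:
  fixes F :: "real ^ 'n \<Rightarrow> real ^ 'm"
  assumes c11: "\<And>i. c11_on (ball b R0) (\<lambda>u. F u $ i)" and "R0 > 0"
    and rank: "full_row_rank (jacobian F (at b))"
  obtains R K M \<kappa> where "regular_near F b R K M \<kappa>"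
proof -
  have "\<exists>g B. B \<ge> 0 \<and> (\<forall>u\<in>ball b R0. ((\<lambda>u. F u $ i) has_derivative (\<lambda>h. g u \<bullet> h)) (at u) \<and>
      (\<forall>v\<in>ball b R0. norm (F u $ i - F v $ i) \<le> B * dist u v \<and> norm (g u - g v) \<le> B * dist u v))" for i
  proof -
    obtain g where g: "bounded_lipschitz_on (ball b R0) (\<lambda>u. F u $ i)" "bounded_lipschitz_on (ball b R0) g"
      "\<And>u. u \<in> ball b R0 \<Longrightarrow> ((\<lambda>u. F u $ i) has_derivative (\<lambda>h. g u \<bullet> h)) (at u)"
      using c11[of i] by (rule c11_onE) blast
    obtain B1 where B1: "\<And>u v. u \<in> ball b R0 \<Longrightarrow> v \<in> ball b R0 \<Longrightarrow> norm (F u $ i - F v $ i) \<le> B1 * dist u v"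
      "B1 \<ge> 0"
      using g(1) unfolding bounded_lipschitz_on_def by blast
    obtain B2 where B2: "\<And>u v. u \<in> ball b R0 \<Longrightarrow> v \<in> ball b R0 \<Longrightarrow> norm (g u - g v) \<le> B2 * dist u v"
      "B2 \<ge> 0"
      using g(2) unfolding bounded_lipschitz_on_def by blast
    have "B1 * dist u v \<le> (B1 + B2) * dist u v" "B2 * dist u v \<le> (B1 + B2) * dist u v" for u v :: "real ^ 'n"
      using B1(2) B2(2) by (auto intro!: mult_right_mono)
    then have "norm (F u $ i - F v $ i) \<le> (B1 + B2) * dist u v \<and> norm (g u - g v) \<le> (B1 + B2) * dist u v"
      if "u \<in> ball b R0" "v \<in> ball b R0" for u v
      using B1(1)[OF that] B2(1)[OF that] order_trans by blast
    then show ?thesis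
      using g(3) B1(2) B2(2) by (intro exI[of _ g] exI[of _ "B1 + B2"]) simp
  qed
  then obtain g B where B0: "\<And>i. B i \<ge> 0"
    and der: "\<And>i u. u \<in> ball b R0 \<Longrightarrow> ((\<lambda>u. F u $ i) has_derivative (\<lambda>h. g i u \<bullet> h)) (at u)"
    and lipF: "\<And>i u v. u \<in> ball b R0 \<Longrightarrow> v \<in> ball b R0 \<Longrightarrow> norm (F u $ i - F v $ i) \<le> B i * dist u v"
    and lipg: "\<And>i u v. u \<in> ball b R0 \<Longrightarrow> v \<in> ball b R0 \<Longrightarrow> norm (g i u - g i v) \<le> B i * dist u v"
    by metis
  define J where "J u = jacobian F (at u)" for u
  have derF: "(F has_derivative (\<lambda>h. \<chi> i. g i u \<bullet> h)) (at u)" if "u \<in> ball b R0" for u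
    using der[OF that]
    by (subst has_derivative_componentwise_within)
      (auto simp: Basis_vec_def inner_axis)
  then have derJ: "(F has_derivative (*v) (J u)) (at u)" if "u \<in> ball b R0" for u
    unfolding J_def using that jacobian_works differentiable_def by blast
  have J_eq: "J u *v h = (\<chi> i. g i u \<bullet> h)" if "u \<in> ball b R0" for u h
    using has_derivative_unique[OF derJ[OF that] derF[OF that]] by metis
  \<comment> \<open>The summand 1 keeps \<open>K\<close> positive when all \<open>B i\<close>
    vanish.\<close>
  define K where "K = (\<Sum>i\<in>UNIV. B i) + 1"
  have K: "K > 0" "(\<Sum>i\<in>UNIV. B i) \<le> K"
    unfolding K_def using sum_nonneg[of UNIV B] B0 by auto
  have lip: "norm (F v - F u) \<le> K * norm (v - u)" if "u \<in> ball b R0" "v \<in> ball b R0" for u v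
  proof -
    have "norm (F v - F u) \<le> (\<Sum>i\<in>UNIV. \<bar>(F v - F u) $ i\<bar>)"
      by (rule norm_le_l1_cart)
    also have "\<dots> \<le> (\<Sum>i\<in>UNIV. B i * dist v u)"
      using lipF[OF that(2,1)] by (intro sum_mono) simp
    also have "\<dots> = (\<Sum>i\<in>UNIV. B i) * dist v u"
      by (simp add: sum_distrib_right)
    also have "\<dots> \<le> K * dist v u"
      by (intro mult_right_mono K) simp
    finally show ?thesis by (simp add: dist_norm)
  qed
  have lipJ: "norm (J v *v h - J u *v h) \<le> K * norm (v - u) * norm h"
    if "u \<in> ball b R0" "v \<in> ball b R0" for u v h
  proof -
    have "norm (J v *v h - J u *v h) \<le> (\<Sum>i\<in>UNIV. \<bar>(J v *v h - J u *v h) $ i\<bar>)"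
      by (rule norm_le_l1_cart)
    also have "\<dots> = (\<Sum>i\<in>UNIV. \<bar>(g i v - g i u) \<bullet> h\<bar>)"
      by (simp add: J_eq[OF that(1)] J_eq[OF that(2)] inner_diff_left)
    also have "\<dots> \<le> (\<Sum>i\<in>UNIV. (B i * dist v u) * norm h)"
      by (intro sum_mono order_trans[OF Cauchy_Schwarz_ineq2] mult_right_mono lipg that) simp
    also have "\<dots> = (\<Sum>i\<in>UNIV. B i) * (dist v u * norm h)"
      by (simp add: sum_distrib_right mult.assoc)
    also have "\<dots> \<le> K * (dist v u * norm h)"
      by (intro mult_right_mono K) simp
    finally show ?thesis by (simp add: dist_norm mult.assoc)
  qed
  have taylor: "norm (F v - F u - J u *v (v - u)) \<le> K * (norm (v - u))\<^sup>2"
    if uv: "u \<in> ball b R0" "v \<in> ball b R0" for u v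
  proof -
    have seg: "closed_segment u v \<subseteq> ball b R0"
      using uv convex_ball convex_contains_segment by blast
    \<comment> \<open>Mean value inequality for \<open>F\<close> minus its linearization at
      \<open>u\<close>: on the segment the derivative differs from \<open>J u\<close> by at most
      \<open>K * norm (v - u)\<close>.\<close>
    have "norm (F v - F u - J u *v (v - u)) \<le> norm (v - u) * (K * norm (v - u))"
    proof (rule differentiable_bound_linearization[where S = "closed_segment u v" and f' = "\<lambda>w. (*v) (J w)"])
      show "u + t *\<^sub>R (v - u) \<in> closed_segment u v" if "t \<in> {0..1}" for t
        using that by (auto simp: closed_segment_def algebra_simps intro!: exI[of _ t])
      show "(F has_derivative (*v) (J w)) (at w within closed_segment u v)"
        if "w \<in> closed_segment u v" for w
        using derJ seg that has_derivative_at_withinI by blast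
      show "onorm ((*v) (J w) - (*v) (J u)) \<le> K * norm (v - u)" if w: "w \<in> closed_segment u v" for w
      proof (rule onorm_le)
        fix h :: "real ^ 'n"
        have "norm (w - u) \<le> norm (v - u)"
          using segment_bound(1)[OF w] by simp
        then have "K * norm (w - u) * norm h \<le> K * norm (v - u) * norm h"
          using K(1) by (intro mult_right_mono mult_left_mono) auto
        moreover have "norm (J w *v h - J u *v h) \<le> K * norm (w - u) * norm h"
          using lipJ[of u w h] uv seg w by blast
        ultimately show "norm (((*v) (J w) - (*v) (J u)) h) \<le> K * norm (v - u) * norm h"
          by simp
      qed
    qed simp
    then show ?thesis by (simp add: power2_eq_square algebra_simps)
  qed
  have "surj ((*v) (J b))"
    using rank unfolding full_row_rank_def J_def full_rank_surjective .
  then obtain \<kappa> \<epsilon> where \<kappa>: "\<kappa> > 0" "\<epsilon> > 0"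
    "\<And>J' z. (\<And>h. norm (J' *v h - J b *v h) \<le> \<epsilon> * norm h) \<Longrightarrow> \<exists>h. J' *v h = z \<and> norm h \<le> \<kappa> * norm z"
    using right_inverse_perturbation[of "J b"] by metis
  \<comment> \<open>Within distance \<open>\<epsilon> / K\<close> of \<open>b\<close> the Lipschitz
    bound keeps \<open>J u\<close> within the tolerance \<epsilon> of \<open>J b\<close>.\<close>
  define R where "R = min R0 (\<epsilon> / K)"
  have R: "R > 0" "R \<le> R0" "R \<le> \<epsilon> / K"
    unfolding R_def using \<open>R0 > 0\<close> \<kappa>(2) K(1) by auto
  have inv: "\<exists>h. J u *v h = z \<and> norm h \<le> \<kappa> * norm z" if u: "u \<in> ball b R" for u z
  proof (rule \<kappa>(3))
    fix h :: "real ^ 'n"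
    have "norm (u - b) \<le> \<epsilon> / K"
      using u R(3) by (simp add: dist_norm norm_minus_commute)
    then have "K * norm (u - b) \<le> \<epsilon>"
      using K(1) by (simp add: field_simps)
    then have "K * norm (u - b) * norm h \<le> \<epsilon> * norm h"
      by (intro mult_right_mono) auto
    moreover have "norm (J u *v h - J b *v h) \<le> K * norm (u - b) * norm h"
      using u R \<open>R0 > 0\<close> by (intro lipJ) auto
    ultimately show "norm (J u *v h - J b *v h) \<le> \<epsilon> * norm h"
      by linarith
  qed
  have "ball b R \<subseteq> ball b R0"
    using R(2) by (simp add: subset_ball)
  \<comment> \<open>\<open>K\<close> bounds both the linearization error and the Lipschitz constant
    of \<open>F\<close>.\<close>
  then have "regular_near F b R K K \<kappa>"
    unfolding regular_near_def
    using R(1) K(1) \<kappa>(1) taylor lip inv by (auto simp: J_def [symmetric] subset_iff)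
  then show thesis by (rule that)
qed

section \<open>Convergence of the linearized proximal algorithm\<close>

text \<open>The distance travelled after step \<open>k\<close> is at most \<open>\<kappa> / (1 - c)\<close> times the decrease of \<open>e\<close>
  from step \<open>k\<close> on.\<close>

lemma contracting_iteration_converges:
  fixes X :: "nat \<Rightarrow> 'a::complete_space"
  assumes "0 \<le> \<kappa>" "0 \<le> c" "c < 1" and e_nonneg: "\<And>u. 0 \<le> e u"
    and step: "\<And>k. X k \<in> ball b R \<Longrightarrow> e (X k) \<le> \<rho> \<Longrightarrow> dist (X k) (X (Suc k)) \<le> \<kappa> * e (X k)"
    and decr: "\<And>k. X k \<in> ball b R \<Longrightarrow> e (X k) \<le> \<rho> \<Longrightarrow> X (Suc k) \<in> ball b R \<Longrightarrow>
      e (X (Suc k)) \<le> c * e (X k)"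
    and start: "e (X 0) \<le> \<rho>" "dist b (X 0) + \<kappa> / (1 - c) * e (X 0) < R"
  obtains s where "X \<longlonglongrightarrow> s" "s \<in> ball b R" "(\<lambda>k. e (X k)) \<longlonglongrightarrow> 0"
    "\<And>k. X k \<in> ball b R" "\<And>k. e (X k) \<le> \<rho>" "\<And>k. dist (X k) s \<le> \<kappa> / (1 - c) * e (X k)"
proof -
  \<comment> \<open>By this choice of \<open>q\<close> a step of length \<kappa> e equals q (e - c
    e), which is at most \<open>q\<close> times the decrease of \<open>e\<close>, so the step
    lengths telescope.\<close>
  define q where "q = \<kappa> / (1 - c)"
  have q: "q \<ge> 0" "\<kappa> = q * (1 - c)"
    unfolding q_def using assms(1,3) by (auto simp: field_simps)
  have inv: "X k \<in> ball b R \<and> e (X k) \<le> \<rho> \<and> dist (X 0) (X k) \<le> q * (e (X 0) - e (X k)) \<and>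
      e (X k) \<le> c ^ k * e (X 0)" for k
  proof (induction k)
    case 0
    have "0 \<le> q * e (X 0)"
      using q(1) e_nonneg by simp
    then show ?case using start by (simp add: q_def)
  next
    case (Suc k)
    have "dist (X 0) (X (Suc k)) \<le> dist (X 0) (X k) + dist (X k) (X (Suc k))"
      by (rule dist_triangle)
    also have "\<dots> \<le> q * (e (X 0) - e (X k)) + q * (1 - c) * e (X k)"
      using Suc step[of k] q(2) by (intro add_mono) auto
    also have "\<dots> = q * (e (X 0) - c * e (X k))"
      by (simp add: algebra_simps)
    finally have d: "dist (X 0) (X (Suc k)) \<le> q * (e (X 0) - c * e (X k))" .
    \<comment> \<open>The hypothesis \<open>decr\<close> presupposes that the next iterate lies in
      the ball. The bound with \<open>c * e (X k)\<close> in place of the next value of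
      \<open>e\<close> establishes this first.\<close>
    have "q * (e (X 0) - c * e (X k)) \<le> q * e (X 0)"
      using q(1) assms(2) e_nonneg by (intro mult_left_mono) auto
    then have mem: "X (Suc k) \<in> ball b R"
      using d start(2) dist_triangle[of b "X (Suc k)" "X 0"] by (simp add: q_def)
    then have ec: "e (X (Suc k)) \<le> c * e (X k)"
      using decr Suc by blast
    have "q * (e (X 0) - c * e (X k)) \<le> q * (e (X 0) - e (X (Suc k)))"
      using ec q(1) by (intro mult_left_mono) auto
    moreover have "c * e (X k) \<le> 1 * e (X k)"
      using assms(3) e_nonneg by (intro mult_right_mono) auto
    moreover have "c * e (X k) \<le> c * (c ^ k * e (X 0))"
      using Suc assms(2) by (intro mult_left_mono) auto
    ultimately show ?case
      using mem ec d Suc by (auto simp: algebra_simps)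
  qed
  \<comment> \<open>The same telescoping, started at step \<open>k\<close>, yields the Cauchy
    property and the distance from the limit.\<close>
  have tail0: "dist (X k) (X (k + n)) \<le> q * (e (X k) - e (X (k + n)))" for k n
  proof (induction n)
    case (Suc n)
    have "\<kappa> * e (X (k + n)) = q * (e (X (k + n)) - c * e (X (k + n)))"
      by (simp add: q(2) algebra_simps)
    also have "\<dots> \<le> q * (e (X (k + n)) - e (X (Suc (k + n))))"
      using q(1) decr[of "k + n"] inv by (intro mult_left_mono) auto
    finally have "dist (X (k + n)) (X (Suc (k + n))) \<le> q * (e (X (k + n)) - e (X (Suc (k + n))))"
      using step[of "k + n"] inv by (meson order_trans)
    then show ?case
      using Suc dist_triangle[of "X k" "X (Suc (k + n))" "X (k + n)"] by (simp add: algebra_simps)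
  qed simp
  have tail: "dist (X k) (X n) \<le> q * e (X k)" if "k \<le> n" for k n
  proof -
    have "q * (e (X k) - e (X n)) \<le> q * e (X k)"
      using q(1) e_nonneg by (intro mult_left_mono) auto
    then show ?thesis
      using tail0[of k "n - k"] that by simp
  qed
  have e0: "(\<lambda>k. e (X k)) \<longlonglongrightarrow> 0"
  proof (rule tendsto_sandwich[OF _ _ tendsto_const])
    show "(\<lambda>k. c ^ k * e (X 0)) \<longlonglongrightarrow> 0"
      using assms(2,3) by (intro tendsto_mult_left_zero LIMSEQ_power_zero) auto
  qed (use inv e_nonneg in auto)
  then have qe0: "(\<lambda>k. q * e (X k)) \<longlonglongrightarrow> 0"
    by (rule tendsto_mult_right_zero)
  have "Cauchy X"
    unfolding Cauchy_altdef
  proof (intro allI impI)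
    fix \<epsilon> :: real assume "\<epsilon> > 0"
    then obtain N where "\<And>k. k \<ge> N \<Longrightarrow> q * e (X k) < \<epsilon>"
      using order_tendstoD(2)[OF qe0] unfolding eventually_sequentially by blast
    then have "\<forall>k\<ge>N. \<forall>n>k. dist (X k) (X n) < \<epsilon>"
      using tail by (meson le_less_trans less_imp_le)
    then show "\<exists>N. \<forall>k\<ge>N. \<forall>n>k. dist (X k) (X n) < \<epsilon>" ..
  qed
  then obtain s where s: "X \<longlonglongrightarrow> s"
    using Cauchy_convergent_iff convergent_def by metis
  have ds: "dist (X k) s \<le> q * e (X k)" for k
    by (rule Lim_bounded[OF tendsto_dist[OF tendsto_const s]]) (use tail in auto)
  have "s \<in> ball b R"
    using ds[of 0] start(2) dist_triangle[of b s "X 0"] by (simp add: q_def)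
  with s e0 inv ds show thesis
    unfolding q_def by (intro that) auto
qed

section \<open>Solvability of the proximal subproblem\<close>

text \<open>The direction is a choice by \<open>arg_min\<close>, so it minimizes only because a
  minimizer exists. A minimizer exists on a compact ball, and outside that ball the proximal term
  alone exceeds the value at 0.\<close>

lemma lpa_direction_le:
  fixes F :: "real ^ 'n \<Rightarrow> real ^ 'm" and u h :: "real ^ 'n"
  assumes "continuous_on UNIV L" and nonneg: "\<And>z. 0 \<le> L z" and "t > 0"
  defines "d \<equiv> lpa_direction L F t u"
  shows "L (F u + jacobian F (at u) *v d) + 1 / (2 * t) * (norm d)\<^sup>2
    \<le> L (F u + jacobian F (at u) *v h) + 1 / (2 * t) * (norm h)\<^sup>2"
proof -
  define \<phi> where "\<phi> \<delta> = L (F u + jacobian F (at u) *v \<delta>) + 1 / (2 * t) * (norm \<delta>)\<^sup>2" for \<delta>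
  \<comment> \<open>The radius at which the proximal term equals \<open>\<phi> 0\<close>.\<close>
  define r where "r = sqrt (2 * t * \<phi> 0)"
  have "\<phi> 0 \<ge> 0"
    unfolding \<phi>_def using nonneg by simp
  then have r: "r \<ge> 0" "r\<^sup>2 = 2 * t * \<phi> 0"
    unfolding r_def using \<open>t > 0\<close> by auto
  have "continuous_on (cball 0 r) \<phi>"
    unfolding \<phi>_def
    by (intro continuous_intros continuous_on_compose2[OF assms(1)]
        linear_continuous_on matrix_vector_mul_bounded_linear) auto
  then obtain m where m: "\<And>\<delta>. \<delta> \<in> cball 0 r \<Longrightarrow> \<phi> m \<le> \<phi> \<delta>"
    using continuous_attains_inf[of "cball 0 r" \<phi>] r(1) by force
  have "\<phi> m \<le> \<phi> \<delta>" for \<delta>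
  proof (cases "\<delta> \<in> cball 0 r")
    case False
    then have "r\<^sup>2 \<le> (norm \<delta>)\<^sup>2"
      using r(1) by (intro power_mono) auto
    then have "\<phi> 0 \<le> 1 / (2 * t) * (norm \<delta>)\<^sup>2"
      using r(2) \<open>t > 0\<close> by (simp add: field_simps)
    also have "\<dots> \<le> \<phi> \<delta>"
      unfolding \<phi>_def using nonneg by simp
    finally show ?thesis
      using m[of 0] r(1) by simp
  qed (rule m)
  then have "is_arg_min \<phi> (\<lambda>_. True) m"
    unfolding is_arg_min_def by (auto simp: not_less)
  then have "is_arg_min \<phi> (\<lambda>_. True) d"
    unfolding d_def lpa_direction_def arg_min_def \<phi>_def by (rule someI)
  then have "\<phi> d \<le> \<phi> h"
    unfolding is_arg_min_def by (auto simp: not_less)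
  then show ?thesis
    unfolding \<phi>_def .
qed

section \<open>Estimates for a single step and convergence of the iterates\<close>

text \<open>The set \<open>C\<close> stands for the minimizers of the loss. The growth of
  \<open>L\<close> away from \<open>C\<close> is left to the convergence results, since it separates
  the linear from the quadratic case.\<close>

locale regular_inclusion =
  fixes F :: "real ^ 'n \<Rightarrow> real ^ 'm" and b :: "real ^ 'n" and R K M \<kappa> :: real
    and L :: "real ^ 'm \<Rightarrow> real" and C :: "(real ^ 'm) set"
  assumes regular: "regular_near F b R K M \<kappa>"
    and closed_C: "closed C" and base_mem: "F b \<in> C"
    and continuous_L: "continuous_on UNIV L" and L_nonneg: "\<And>z. 0 \<le> L z"
    and L_zero: "\<And>z. z \<in> C \<Longrightarrow> L z = 0"
begin

definition err :: "real ^ 'n \<Rightarrow> real" where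
  "err u = infdist (F u) C"

definition model :: "real \<Rightarrow> real ^ 'n \<Rightarrow> real ^ 'm" where
  "model t u = F u + jacobian F (at u) *v lpa_direction L F t u"

lemma constants_pos: "R > 0" "K > 0" "M > 0" "\<kappa> > 0"
  using regular unfolding regular_near_def by auto

lemma minimizersI:
  assumes "F s \<in> C"
  shows "s \<in> minimizers (\<lambda>u. L (F u))"
  using L_zero[OF assms] L_nonneg by (simp add: minimizers_def is_arg_min_def not_less)

lemma taylor:
  assumes "u \<in> ball b R" "v \<in> ball b R"
  shows "norm (F v - F u - jacobian F (at u) *v (v - u)) \<le> K * (norm (v - u))\<^sup>2"
  using regular assms unfolding regular_near_def by blast

lemma lipschitz:
  assumes "u \<in> ball b R" "v \<in> ball b R"
  shows "norm (F v - F u) \<le> M * norm (v - u)"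
  using regular assms unfolding regular_near_def by blast

lemma jacobian_solve:
  assumes "u \<in> ball b R"
  obtains h where "jacobian F (at u) *v h = z" "norm h \<le> \<kappa> * norm z"
  using regular assms unfolding regular_near_def by blast

lemma err_nonneg: "0 \<le> err u"
  unfolding err_def by (rule infdist_nonneg)

text \<open>The point \<open>F v\<close> competes in the distance to \<open>C\<close>. The case of
  \<open>b\<close> bounds the initial error; the case of the limit turns rates for
  \<open>err\<close> into rates for the iterates.\<close>

lemma err_le:
  assumes "u \<in> ball b R" "v \<in> ball b R" "F v \<in> C"
  shows "err u \<le> M * dist u v"
proof -
  have "err u \<le> dist (F u) (F v)"
    unfolding err_def by (rule infdist_le[OF assms(3)])
  also have "\<dots> \<le> M * dist u v"
    using lipschitz[OF assms(2,1)] by (simp add: dist_norm)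
  finally show ?thesis .
qed

text \<open>Compare the direction with the least effort needed to make the linear model feasible.\<close>

lemma model_bound:
  assumes "u \<in> ball b R" "t > 0"
  shows "L (model t u) + 1 / (2 * t) * (norm (lpa_direction L F t u))\<^sup>2 \<le> 1 / (2 * t) * (\<kappa> * err u)\<^sup>2"
proof -
  obtain p where p: "p \<in> C" "err u = dist (F u) p"
    using infdist_attains_inf[OF closed_C] base_mem unfolding err_def by blast
  obtain h where h: "jacobian F (at u) *v h = p - F u" "norm h \<le> \<kappa> * norm (p - F u)"
    using jacobian_solve[OF assms(1)] by blast
  have "norm h \<le> \<kappa> * err u"
    using h(2) p(2) by (simp add: dist_norm norm_minus_commute)
  then have "1 / (2 * t) * (norm h)\<^sup>2 \<le> 1 / (2 * t) * (\<kappa> * err u)\<^sup>2"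
    using \<open>t > 0\<close> by (intro mult_left_mono power_mono) auto
  moreover have "F u + jacobian F (at u) *v h = p"
    using h(1) by simp
  ultimately show ?thesis
    using lpa_direction_le[OF continuous_L L_nonneg \<open>t > 0\<close>, of F u h] L_zero[OF p(1)]
    unfolding model_def by simp
qed

lemma direction_bound:
  assumes "u \<in> ball b R" "t > 0"
  shows "norm (lpa_direction L F t u) \<le> \<kappa> * err u"
proof -
  have "1 / (2 * t) * (norm (lpa_direction L F t u))\<^sup>2 \<le> 1 / (2 * t) * (\<kappa> * err u)\<^sup>2"
    using model_bound[OF assms] L_nonneg[of "model t u"] by linarith
  then have "(norm (lpa_direction L F t u))\<^sup>2 \<le> (\<kappa> * err u)\<^sup>2"
    using \<open>t > 0\<close> by (simp add: divide_le_cancel)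
  then show ?thesis
    by (rule power2_le_imp_le) (use constants_pos err_nonneg in auto)
qed

lemma loss_model_le:
  assumes "u \<in> ball b R" "t > 0"
  shows "L (model t u) \<le> (\<kappa> * err u)\<^sup>2 / (2 * t)"
proof -
  have "0 \<le> 1 / (2 * t) * (norm (lpa_direction L F t u))\<^sup>2"
    using \<open>t > 0\<close> by simp
  then show ?thesis
    using model_bound[OF assms] by simp
qed

text \<open>The new value differs from the model value by the linearization error, and
  \<open>direction_bound\<close> makes that quadratic in \<open>err u\<close>. What remains for each
  kind of growth is the distance of the model value from \<open>C\<close>.\<close>

lemma err_step_le:
  assumes "u \<in> ball b R" "t > 0" "u + lpa_direction L F t u \<in> ball b R"
  shows "err (u + lpa_direction L F t u) \<le> infdist (model t u) C + K * (\<kappa> * err u)\<^sup>2"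
proof -
  let ?d = "lpa_direction L F t u"
  have "dist (F (u + ?d)) (model t u) \<le> K * (norm ?d)\<^sup>2"
    using taylor[OF assms(1,3)] by (simp add: model_def dist_norm algebra_simps)
  also have "\<dots> \<le> K * (\<kappa> * err u)\<^sup>2"
    using direction_bound[OF assms(1,2)] constants_pos by (intro mult_left_mono power_mono) auto
  finally show ?thesis
    unfolding err_def using infdist_triangle[of "F (u + ?d)" C "model t u"] by linarith
qed

text \<open>The direction bound makes this an instance of the abstract contracting iteration. The
  limit lies over \<open>C\<close> because \<open>err\<close> tends to 0 and \<open>C\<close> is
  closed; the last two conclusions make \<open>err\<close> comparable with the distance from the
  limit.\<close>

lemma lpa_converges:
  assumes "t > 0" "0 \<le> c" "c < 1"
    and decr: "\<And>u. u \<in> ball b R \<Longrightarrow> err u \<le> \<rho> \<Longrightarrow> u + lpa_direction L F t u \<in> ball b R \<Longrightarrow>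
      err (u + lpa_direction L F t u) \<le> c * err u"
    and r: "M * r \<le> \<rho>" "r + \<kappa> / (1 - c) * (M * r) \<le> R" and u0: "u0 \<in> ball b r"
  obtains s where "lpa L F t u0 \<longlonglongrightarrow> s" "F s \<in> C"
    "\<And>k. lpa L F t u0 k \<in> ball b R" "\<And>k. err (lpa L F t u0 k) \<le> \<rho>"
    "\<And>k. dist (lpa L F t u0 k) s \<le> \<kappa> / (1 - c) * err (lpa L F t u0 k)"
    "\<And>k. err (lpa L F t u0 k) \<le> M * dist (lpa L F t u0 k) s"
proof -
  have "0 < r"
    using u0 zero_le_dist[of b u0] by (simp del: zero_le_dist)
  have q: "0 \<le> \<kappa> / (1 - c)"
    using \<open>c < 1\<close> constants_pos by simp
  have "0 \<le> \<kappa> / (1 - c) * (M * r)"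
    using \<open>0 < r\<close> constants_pos by (intro mult_nonneg_nonneg[OF q]) auto
  then have "b \<in> ball b R" "u0 \<in> ball b R"
    using r(2) u0 constants_pos by auto
  then have "err u0 \<le> M * dist u0 b"
    by (intro err_le base_mem)
  also have "\<dots> \<le> M * r"
    using u0 constants_pos by (intro mult_left_mono) (auto simp: dist_commute)
  finally have err0: "err u0 \<le> M * r" .
  have "\<kappa> / (1 - c) * err u0 \<le> \<kappa> / (1 - c) * (M * r)"
    by (intro mult_left_mono err0 q)
  then have start: "dist b u0 + \<kappa> / (1 - c) * err u0 < R"
    using u0 r(2) by simp
  obtain s where s: "lpa L F t u0 \<longlonglongrightarrow> s" "s \<in> ball b R" "(\<lambda>k. err (lpa L F t u0 k)) \<longlonglongrightarrow> 0"
    "\<And>k. lpa L F t u0 k \<in> ball b R" "\<And>k. err (lpa L F t u0 k) \<le> \<rho>"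
    "\<And>k. dist (lpa L F t u0 k) s \<le> \<kappa> / (1 - c) * err (lpa L F t u0 k)"
  proof (rule contracting_iteration_converges[of \<kappa> c err "lpa L F t u0" b R \<rho>])
    fix k assume "lpa L F t u0 k \<in> ball b R"
    then show "dist (lpa L F t u0 k) (lpa L F t u0 (Suc k)) \<le> \<kappa> * err (lpa L F t u0 k)"
      using direction_bound[OF _ \<open>t > 0\<close>] by (simp add: dist_norm)
  qed (use assms(2,3) constants_pos err_nonneg decr start err0 r(1) in auto)
  have "(\<lambda>k. M * dist (lpa L F t u0 k) s) \<longlonglongrightarrow> M * dist s s"
    by (intro tendsto_intros s(1))
  then have lim: "(\<lambda>k. M * dist (lpa L F t u0 k) s) \<longlonglongrightarrow> 0"
    by simp
  have "norm (F (lpa L F t u0 k) - F s) \<le> M * dist (lpa L F t u0 k) s" for k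
    using lipschitz[OF s(2) s(4)] by (simp only: dist_norm)
  then have "(\<lambda>k. F (lpa L F t u0 k) - F s) \<longlonglongrightarrow> 0"
    by (intro Lim_null_comparison[OF always_eventually lim] allI)
  then have "(\<lambda>k. err (lpa L F t u0 k)) \<longlonglongrightarrow> infdist (F s) C"
    unfolding err_def by (intro tendsto_infdist) (simp add: LIM_zero_iff)
  then have "infdist (F s) C = 0"
    using s(3) LIMSEQ_unique by blast
  then have "F s \<in> C"
    using in_closed_iff_infdist_zero[OF closed_C] base_mem by blast
  show thesis
    by (rule that[OF s(1) \<open>F s \<in> C\<close> s(4-6) err_le[OF s(4) s(2) \<open>F s \<in> C\<close>]])
qed

lemma starting_radius:
  assumes "\<rho> > 0" "c < 1"
  obtains r where "r > 0" "M * r \<le> \<rho>" "r + \<kappa> / (1 - c) * (M * r) \<le> R"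
proof -
  \<comment> \<open>Both requirements are linear in \<open>r\<close>: the second one reads a r \<le>
    R.\<close>
  define a where "a = 1 + \<kappa> / (1 - c) * M"
  have a: "a > 0"
    unfolding a_def using constants_pos \<open>c < 1\<close> by (intro add_pos_nonneg) auto
  define r where "r = min (\<rho> / M) (R / a)"
  have "r > 0"
    unfolding r_def using assms a constants_pos by simp
  moreover have "r \<le> \<rho> / M" "r \<le> R / a"
    unfolding r_def by simp_all
  then have "M * r \<le> \<rho>" "a * r \<le> R"
    using a constants_pos by (simp_all add: pos_le_divide_eq mult.commute)
  then have "M * r \<le> \<rho>" "r + \<kappa> / (1 - c) * (M * r) \<le> R"
    by (simp_all add: a_def algebra_simps)
  ultimately show thesis
    by (rule that)
qed

section \<open>Linear convergence under quadratic growth\<close>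

text \<open>A contraction factor \<open>c\<close> is split in halves: large \<open>t\<close> brings
  the model value within c/2 times \<open>err u\<close> of \<open>C\<close>, and small
  \<open>err u\<close> does the same for the linearization error. As \<open>c\<close> and \<rho> are
  fixed before \<open>t\<close>, one radius serves all \<open>t\<close> beyond the
  threshold.\<close>

lemma lpa_linearly_converges:
  assumes "\<alpha> > 0" and growth: "\<And>z. (infdist z C)\<^sup>2 \<le> \<alpha> * L z"
  shows "\<exists>r>0. \<exists>T>0. \<forall>t\<ge>T. \<forall>u0\<in>ball b r. \<exists>s. linearly_converges (lpa L F t u0) s \<and> s \<in> minimizers (\<lambda>u. L (F u)) \<and> F s \<in> C"
proof -
  \<comment> \<open>Contraction of \<open>err\<close> by \<open>c\<close> contracts the distance
    from the limit by \<kappa> c M / (1 - c), which is below 1 exactly when c (\<kappa> M + 1) <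
    1.\<close>
  define c where "c = 1 / (2 * (\<kappa> * M + 1))"
  have \<kappa>M: "\<kappa> * M > 0"
    using constants_pos by simp
  have c: "0 < c" "c < 1" "c * (\<kappa> * M + 1) = 1 / 2"
    unfolding c_def using \<kappa>M by (simp_all add: field_simps)
  define \<rho> where "\<rho> = c / (2 * (K * \<kappa>\<^sup>2))"
  have \<rho>: "\<rho> > 0" "K * \<kappa>\<^sup>2 * \<rho> = c / 2"
    unfolding \<rho>_def using c constants_pos by auto
  \<comment> \<open>At this value of \<open>t\<close> the factor
    \<open>\<alpha> * \<kappa>\<^sup>2 / (2 * t)\<close> equals
    \<open>(c / 2)\<^sup>2\<close>.\<close>
  define T where "T = 2 * \<alpha> * \<kappa>\<^sup>2 / c\<^sup>2"
  have T: "T > 0"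
    unfolding T_def using c constants_pos \<open>\<alpha> > 0\<close> by simp
  define q where "q = \<kappa> / (1 - c) * (c * M)"
  have q: "0 < q" "q < 1"
    unfolding q_def using c constants_pos by (auto simp: field_simps)
  have decr: "err (u + lpa_direction L F t u) \<le> c * err u"
    if "t \<ge> T" and u: "u \<in> ball b R" "err u \<le> \<rho>" "u + lpa_direction L F t u \<in> ball b R" for t u
  proof -
    have t: "t > 0"
      using T that by simp
    have "2 * \<alpha> * \<kappa>\<^sup>2 \<le> t * c\<^sup>2"
      using \<open>t \<ge> T\<close> c unfolding T_def by (simp add: field_simps)
    then have ratio: "\<alpha> * \<kappa>\<^sup>2 / (2 * t) \<le> (c / 2)\<^sup>2"
      using t by (simp add: field_simps power2_eq_square)
    have "(infdist (model t u) C)\<^sup>2 \<le> \<alpha> * L (model t u)"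
      by (rule growth)
    also have "\<dots> \<le> \<alpha> * ((\<kappa> * err u)\<^sup>2 / (2 * t))"
      using \<open>\<alpha> > 0\<close> loss_model_le[OF u(1) t] by (intro mult_left_mono) auto
    also have "\<dots> = \<alpha> * \<kappa>\<^sup>2 / (2 * t) * (err u)\<^sup>2"
      by (simp add: power_mult_distrib)
    also have "\<dots> \<le> (c / 2)\<^sup>2 * (err u)\<^sup>2"
      by (intro mult_right_mono ratio) simp
    also have "\<dots> = (c / 2 * err u)\<^sup>2"
      by (simp only: power_mult_distrib)
    finally have "infdist (model t u) C \<le> c / 2 * err u"
      by (rule power2_le_imp_le) (use c err_nonneg in auto)
    moreover have "K * (\<kappa> * err u)\<^sup>2 \<le> c / 2 * err u"
    proof -
      have "K * (\<kappa> * err u)\<^sup>2 = K * \<kappa>\<^sup>2 * err u * err u"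
        by (simp add: power2_eq_square algebra_simps)
      also have "\<dots> \<le> K * \<kappa>\<^sup>2 * \<rho> * err u"
        using u(2) constants_pos err_nonneg by (intro mult_right_mono mult_left_mono) auto
      finally show ?thesis
        by (simp add: \<rho>(2))
    qed
    ultimately show ?thesis
      using err_step_le[OF u(1) t u(3)] by linarith
  qed
  obtain r where r: "r > 0" "M * r \<le> \<rho>" "r + \<kappa> / (1 - c) * (M * r) \<le> R"
    using starting_radius[OF \<rho>(1) c(2)] by blast
  have "\<exists>s. linearly_converges (lpa L F t u0) s \<and> s \<in> minimizers (\<lambda>u. L (F u)) \<and> F s \<in> C" if t: "t \<ge> T" and u0: "u0 \<in> ball b r" for t u0
  proof -
    have "t > 0"
      using T t by simp
    obtain s where s: "lpa L F t u0 \<longlonglongrightarrow> s" "F s \<in> C"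
      "\<And>k. lpa L F t u0 k \<in> ball b R" "\<And>k. err (lpa L F t u0 k) \<le> \<rho>"
      "\<And>k. dist (lpa L F t u0 k) s \<le> \<kappa> / (1 - c) * err (lpa L F t u0 k)"
      "\<And>k. err (lpa L F t u0 k) \<le> M * dist (lpa L F t u0 k) s"
      using lpa_converges[OF \<open>t > 0\<close> less_imp_le[OF c(1)] c(2) decr[OF t] r(2,3) u0] by blast
    have "dist (lpa L F t u0 (Suc k)) s \<le> q * dist (lpa L F t u0 k) s" for k
    proof -
      have "err (lpa L F t u0 (Suc k)) \<le> c * err (lpa L F t u0 k)"
        using decr[OF t s(3)[of k] s(4)[of k]] s(3)[of "Suc k"] by simp
      also have "\<dots> \<le> c * (M * dist (lpa L F t u0 k) s)"
        using c(1) s(6)[of k] by (intro mult_left_mono) auto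
      finally have "\<kappa> / (1 - c) * err (lpa L F t u0 (Suc k)) \<le> \<kappa> / (1 - c) * (c * (M * dist (lpa L F t u0 k) s))"
        using c constants_pos by (intro mult_left_mono) auto
      then show ?thesis
        using s(5)[of "Suc k"] unfolding q_def by (simp only: mult.assoc)
    qed
    then have "linearly_converges (lpa L F t u0) s"
      unfolding linearly_converges_def
      by (intro conjI s(1) exI[of _ q] q always_eventually allI)
    then show ?thesis
      using s(2) minimizersI by blast
  qed
  then show ?thesis
    using r(1) T by blast
qed

section \<open>Exact penalty and quadratic convergence under linear growth\<close>

text \<open>A weak sharp minimum makes the penalty exact: near \<open>b\<close> the linear model is solved exactly,
  since otherwise the gain in the loss from correcting it, linear in the defect, would outweigh
  the extra effort.\<close>

lemma model_mem:
  assumes "\<alpha> > 0" and sharp: "\<And>z. infdist z C \<le> \<alpha> * L z"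
    and u: "u \<in> ball b R" and "t > 0" and small: "\<alpha> * \<kappa>\<^sup>2 * err u \<le> 2 * t / 3"
  shows "model t u \<in> C"
proof (rule ccontr)
  assume "model t u \<notin> C"
  define D where "D = infdist (model t u) C"
  define e where "e = err u"
  define d where "d = lpa_direction L F t u"
  have D: "D > 0"
    using \<open>model t u \<notin> C\<close> in_closed_iff_infdist_zero[OF closed_C] base_mem infdist_nonneg[of "model t u" C]
    unfolding D_def by (metis empty_iff less_le)
  have D_le: "D \<le> \<alpha> * L (model t u)"
    unfolding D_def by (rule sharp)
  obtain p where p: "p \<in> C" "D = dist (model t u) p"
    using infdist_attains_inf[OF closed_C] base_mem unfolding D_def by blast
  obtain h where h: "jacobian F (at u) *v h = p - model t u" "norm h \<le> \<kappa> * norm (p - model t u)"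
    using jacobian_solve[OF u] by blast
  have h_le: "norm h \<le> \<kappa> * D"
    using h(2) p(2) by (simp add: dist_norm norm_minus_commute)
  have d_le: "norm d \<le> \<kappa> * e"
    unfolding d_def e_def by (rule direction_bound[OF u \<open>t > 0\<close>])
  \<comment> \<open>The competitor \<open>d + h\<close> corrects the model value to its nearest
    point in \<open>C\<close>, where the loss vanishes.\<close>
  have "F u + jacobian F (at u) *v (d + h) = p"
    using h(1) unfolding model_def d_def by (simp add: matrix_vector_right_distrib)
  then have "L (model t u) + 1 / (2 * t) * (norm d)\<^sup>2 \<le> 1 / (2 * t) * (norm (d + h))\<^sup>2"
    using lpa_direction_le[OF continuous_L L_nonneg \<open>t > 0\<close>, of F u "d + h"] L_zero[OF p(1)]
    unfolding model_def d_def by simp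
  then have "2 * t * (L (model t u) + 1 / (2 * t) * (norm d)\<^sup>2) \<le> 2 * t * (1 / (2 * t) * (norm (d + h))\<^sup>2)"
    using \<open>t > 0\<close> by (intro mult_left_mono) auto
  then have "2 * t * L (model t u) + (norm d)\<^sup>2 \<le> (norm (d + h))\<^sup>2"
    using \<open>t > 0\<close> by (simp add: distrib_left)
  also have "\<dots> \<le> (norm d + norm h)\<^sup>2"
    by (intro power_mono norm_triangle_ineq) simp
  also have "\<dots> = (norm d)\<^sup>2 + norm h * (2 * norm d + norm h)"
    by (simp add: power2_eq_square algebra_simps)
  finally have "2 * t * L (model t u) \<le> norm h * (2 * norm d + norm h)"
    by simp
  also have "\<dots> \<le> (\<kappa> * D) * (2 * (\<kappa> * e) + \<kappa> * D)"
    using h_le d_le constants_pos D by (intro mult_mono) auto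
  finally have gain: "2 * t * L (model t u) \<le> \<kappa>\<^sup>2 * D * (2 * e + D)"
    by (simp add: power2_eq_square algebra_simps)
  have "e > 0"
  proof (rule ccontr)
    assume "\<not> e > 0"
    then have "e = 0"
      using err_nonneg[of u] unfolding e_def by simp
    then have "L (model t u) \<le> 0"
      using loss_model_le[OF u \<open>t > 0\<close>] by (simp add: e_def)
    then have "\<alpha> * L (model t u) \<le> 0"
      using \<open>\<alpha> > 0\<close> by (intro mult_nonneg_nonpos) auto
    then show False
      using D D_le by linarith
  qed
  \<comment> \<open>A first crude bound on the defect, which reduces the factor
    \<open>2 * e + D\<close> in \<open>gain\<close> to 7/3 e.\<close>
  have "D \<le> \<alpha> * ((\<kappa> * e)\<^sup>2 / (2 * t))"
    using D_le loss_model_le[OF u \<open>t > 0\<close>] \<open>\<alpha> > 0\<close> unfolding e_def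
    by (meson less_imp_le mult_left_mono order_trans)
  also have "\<dots> = (\<alpha> * \<kappa>\<^sup>2 * e) * e / (2 * t)"
    by (simp add: power2_eq_square)
  also have "\<dots> \<le> (2 * t / 3) * e / (2 * t)"
    using small \<open>e > 0\<close> \<open>t > 0\<close> unfolding e_def by (intro divide_right_mono mult_right_mono) auto
  also have "\<dots> = e / 3"
    using \<open>t > 0\<close> by simp
  finally have De: "D \<le> e / 3" .
  \<comment> \<open>The chain ends in 2 t D \<le> (14/9) t D, which is impossible for positive
    \<open>D\<close>.\<close>
  have "2 * t * D \<le> 2 * t * (\<alpha> * L (model t u))"
    using D_le \<open>t > 0\<close> by (intro mult_left_mono) auto
  also have "\<dots> = \<alpha> * (2 * t * L (model t u))"
    by simp
  also have "\<dots> \<le> \<alpha> * (\<kappa>\<^sup>2 * D * (2 * e + D))"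
    using gain \<open>\<alpha> > 0\<close> by (intro mult_left_mono) auto
  also have "\<dots> \<le> \<alpha> * (\<kappa>\<^sup>2 * D * (7 / 3 * e))"
    using De \<open>\<alpha> > 0\<close> D by (intro mult_left_mono) auto
  also have "\<dots> = 7 / 3 * D * (\<alpha> * \<kappa>\<^sup>2 * e)"
    by simp
  also have "\<dots> \<le> 7 / 3 * D * (2 * t / 3)"
    using small D unfolding e_def by (intro mult_left_mono) auto
  finally have "t * D \<le> 0"
    by (simp add: mult.commute)
  moreover have "t * D > 0"
    using \<open>t > 0\<close> D by simp
  ultimately show False
    by linarith
qed

text \<open>With the model value in \<open>C\<close>, only the quadratic linearization error
  survives in \<open>err_step_le\<close>. The smallness required for this depends on
  \<open>t\<close>, and so does the radius.\<close>

lemma lpa_quadratically_converges: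
  assumes "\<alpha> > 0" and sharp: "\<And>z. infdist z C \<le> \<alpha> * L z" and "t > 0"
  shows "\<exists>r>0. \<forall>u0\<in>ball b r. \<exists>s. quadratically_converges (lpa L F t u0) s \<and> s \<in> minimizers (\<lambda>u. L (F u)) \<and> F s \<in> C"
proof -
  \<comment> \<open>The first bound makes \<open>err\<close> shrink at least by half; the second is
    the smallness condition of \<open>model_mem\<close>.\<close>
  define \<rho> where "\<rho> = min (1 / (2 * (K * \<kappa>\<^sup>2))) (2 * t / (3 * (\<alpha> * \<kappa>\<^sup>2)))"
  have \<rho>: "\<rho> > 0"
    unfolding \<rho>_def using constants_pos assms(1,3) by auto
  have "\<rho> \<le> 1 / (2 * (K * \<kappa>\<^sup>2))" "\<rho> \<le> 2 * t / (3 * (\<alpha> * \<kappa>\<^sup>2))"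
    unfolding \<rho>_def by simp_all
  then have \<rho>1: "K * \<kappa>\<^sup>2 * \<rho> \<le> 1 / 2" and \<rho>2: "\<alpha> * \<kappa>\<^sup>2 * \<rho> \<le> 2 * t / 3"
    using constants_pos assms(1) by (simp_all add: field_simps)
  have quad: "err (u + lpa_direction L F t u) \<le> K * \<kappa>\<^sup>2 * (err u)\<^sup>2"
    if u: "u \<in> ball b R" "err u \<le> \<rho>" "u + lpa_direction L F t u \<in> ball b R" for u
  proof -
    have "\<alpha> * \<kappa>\<^sup>2 * err u \<le> \<alpha> * \<kappa>\<^sup>2 * \<rho>"
      using u(2) \<open>\<alpha> > 0\<close> by (intro mult_left_mono) auto
    then have "model t u \<in> C"
      using \<rho>2 by (intro model_mem[OF \<open>\<alpha> > 0\<close> sharp u(1) \<open>t > 0\<close>]) auto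
    then have "infdist (model t u) C = 0"
      by simp
    then show ?thesis
      using err_step_le[OF u(1) \<open>t > 0\<close> u(3)] by (simp add: power_mult_distrib mult.assoc)
  qed
  have decr: "err (u + lpa_direction L F t u) \<le> 1 / 2 * err u"
    if u: "u \<in> ball b R" "err u \<le> \<rho>" "u + lpa_direction L F t u \<in> ball b R" for u
  proof -
    have "err (u + lpa_direction L F t u) \<le> (K * \<kappa>\<^sup>2 * err u) * err u"
      using quad[OF u] by (simp add: power2_eq_square mult.assoc)
    also have "\<dots> \<le> (K * \<kappa>\<^sup>2 * \<rho>) * err u"
      using u(2) constants_pos err_nonneg by (intro mult_right_mono mult_left_mono) auto
    also have "\<dots> \<le> 1 / 2 * err u"
      by (intro mult_right_mono \<rho>1 err_nonneg)
    finally show ?thesis .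
  qed
  obtain r where r: "r > 0" "M * r \<le> \<rho>" "r + \<kappa> / (1 - 1 / 2) * (M * r) \<le> R"
    using starting_radius[OF \<rho>, of "1 / 2"] by auto
  \<comment> \<open>The factor \<open>M\<^sup>2\<close> comes from bounding \<open>err\<close> by
    the distance from the limit, the factor \<open>\<kappa> / (1 - 1 / 2)\<close> from the way
    back.\<close>
  define Q where "Q = \<kappa> / (1 - 1 / 2) * (K * \<kappa>\<^sup>2 * M\<^sup>2)"
  have Q: "Q > 0"
    unfolding Q_def using constants_pos by simp
  have "\<exists>s. quadratically_converges (lpa L F t u0) s \<and> s \<in> minimizers (\<lambda>u. L (F u)) \<and> F s \<in> C" if u0: "u0 \<in> ball b r" for u0
  proof -
    obtain s where s: "lpa L F t u0 \<longlonglongrightarrow> s" "F s \<in> C"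
      "\<And>k. lpa L F t u0 k \<in> ball b R" "\<And>k. err (lpa L F t u0 k) \<le> \<rho>"
      "\<And>k. dist (lpa L F t u0 k) s \<le> \<kappa> / (1 - 1 / 2) * err (lpa L F t u0 k)"
      "\<And>k. err (lpa L F t u0 k) \<le> M * dist (lpa L F t u0 k) s"
      using lpa_converges[OF \<open>t > 0\<close> _ _ decr r(2,3) u0] by auto
    have "dist (lpa L F t u0 (Suc k)) s \<le> Q * (dist (lpa L F t u0 k) s)\<^sup>2" for k
    proof -
      have "err (lpa L F t u0 (Suc k)) \<le> K * \<kappa>\<^sup>2 * (err (lpa L F t u0 k))\<^sup>2"
        using quad[OF s(3)[of k] s(4)[of k]] s(3)[of "Suc k"] by simp
      also have "\<dots> \<le> K * \<kappa>\<^sup>2 * (M * dist (lpa L F t u0 k) s)\<^sup>2"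
        using s(6)[of k] constants_pos err_nonneg by (intro mult_left_mono power_mono) auto
      also have "\<dots> = K * \<kappa>\<^sup>2 * M\<^sup>2 * (dist (lpa L F t u0 k) s)\<^sup>2"
        by (simp add: power_mult_distrib)
      finally have "\<kappa> / (1 - 1 / 2) * err (lpa L F t u0 (Suc k))
          \<le> \<kappa> / (1 - 1 / 2) * (K * \<kappa>\<^sup>2 * M\<^sup>2 * (dist (lpa L F t u0 k) s)\<^sup>2)"
        using constants_pos by (intro mult_left_mono) auto
      then show ?thesis
        using s(5)[of "Suc k"] unfolding Q_def by (simp only: mult.assoc)
    qed
    then have "quadratically_converges (lpa L F t u0) s"
      unfolding quadratically_converges_def
      by (intro conjI s(1) exI[of _ Q] Q always_eventually allI)
    then show ?thesis
      using s(2) minimizersI by blast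
  qed
  then show ?thesis
    using r(1) by blast
qed

end

section \<open>The three loss functions\<close>

lemma minimizers_le: "z \<in> minimizers g \<Longrightarrow> g z \<le> g w"
  by (auto simp: minimizers_def is_arg_min_def not_less)

lemma quadratic_loss_nonneg: "0 \<le> quadratic_loss z"
  by (simp add: quadratic_loss_def)

lemma quadratic_loss_eq_0_iff: "quadratic_loss z = 0 \<longleftrightarrow> z = 0"
  by (simp add: quadratic_loss_def)

lemma continuous_on_quadratic_loss: "continuous_on S quadratic_loss"
  unfolding quadratic_loss_def [abs_def] by (intro continuous_intros)

lemma absolute_loss_nonneg: "0 \<le> absolute_loss z"
  by (simp add: absolute_loss_def sum_nonneg)

lemma absolute_loss_eq_0_iff: "absolute_loss z = 0 \<longleftrightarrow> z = 0"
  by (simp add: absolute_loss_def sum_nonneg_eq_0_iff vec_eq_iff)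

lemma continuous_on_absolute_loss: "continuous_on S absolute_loss"
  unfolding absolute_loss_def [abs_def] by (intro continuous_intros)

lemma hinge_loss_nonneg: "0 \<le> hinge_loss z"
  by (simp add: hinge_loss_def sum_nonneg)

lemma hinge_loss_eq_0_iff: "hinge_loss z = 0 \<longleftrightarrow> (\<forall>i. z $ i \<ge> 1)"
  by (auto simp: hinge_loss_def sum_nonneg_eq_0_iff max_def)

lemma continuous_on_hinge_loss: "continuous_on S hinge_loss"
  unfolding hinge_loss_def [abs_def] by (intro continuous_intros)

section \<open>Growth of the losses away from their minimizers\<close>

lemma infdist_quadratic_loss: "(infdist z {0})\<^sup>2 \<le> real CARD('m) * quadratic_loss z"
  for z :: "real ^ 'm::finite"
  by (simp add: quadratic_loss_def)

lemma infdist_absolute_loss: "infdist z {0} \<le> real CARD('m) * absolute_loss z"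
  for z :: "real ^ 'm::finite"
  using norm_le_l1_cart[of z] by (simp add: absolute_loss_def)

lemma infdist_hinge_loss: "infdist z {w. \<forall>i. w $ i \<ge> 1} \<le> real CARD('m) * hinge_loss z"
  for z :: "real ^ 'm::finite"
proof -
  \<comment> \<open>The componentwise projection of \<open>z\<close> onto the set; component
    \<open>i\<close> moves by exactly the hinge term of \<open>z $ i\<close>.\<close>
  define w :: "real ^ 'm" where "w = (\<chi> i. max (z $ i) 1)"
  have "infdist z {w. \<forall>i. w $ i \<ge> 1} \<le> dist z w"
    by (rule infdist_le) (simp add: w_def)
  also have "\<dots> \<le> (\<Sum>i\<in>UNIV. \<bar>(z - w) $ i\<bar>)"
    unfolding dist_norm by (rule norm_le_l1_cart)
  also have "\<dots> = (\<Sum>i\<in>UNIV. max (1 - z $ i) 0)"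
    by (intro sum.cong) (auto simp: w_def max_def)
  also have "\<dots> = real CARD('m) * hinge_loss z"
    by (simp add: hinge_loss_def)
  finally show ?thesis .
qed

section \<open>Regularity of the network maps and conclusion\<close>

lemma regular_near_residual_map:
  fixes x :: "'m::finite \<Rightarrow> real ^ 'd::finite" and b :: "('q::finite, 'd) params"
  assumes "full_row_rank (jacobian (residual_map x y) (at b))"
  obtains R K M \<kappa> where "regular_near (residual_map x y) b R K M \<kappa>"
proof (rule regular_nearI[of b 1 "residual_map x y"])
  show "c11_on (ball b 1) (\<lambda>u. residual_map x y u $ i)" for i
    \<comment> \<open>The subtraction is kept as addition of a constant so that the closure rule for
      sums applies.\<close>
    unfolding residual_map_def diff_conv_add_uminus
    by (simp del: add_uminus_conv_diff) (intro c11_on_add c11_on_network c11_on_const bounded_ball)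
qed (use assms in \<open>auto intro: that\<close>)

lemma regular_near_margin_map:
  fixes x :: "'m::finite \<Rightarrow> real ^ 'd::finite" and b :: "('q::finite, 'd) params"
  assumes "full_row_rank (jacobian (margin_map x y) (at b))"
  obtains R K M \<kappa> where "regular_near (margin_map x y) b R K M \<kappa>"
proof (rule regular_nearI[of b 1 "margin_map x y"])
  show "c11_on (ball b 1) (\<lambda>u. margin_map x y u $ i)" for i
    unfolding margin_map_def
    by simp (intro c11_on_mult c11_on_network c11_on_const bounded_ball)
qed (use assms in \<open>auto intro: that\<close>)

theorem corollary4:
  fixes x :: "'m::finite \<Rightarrow> real ^ 'd::finite"
    and y :: "'m \<Rightarrow> real"
    and \<theta>b :: "('q::finite, 'd) params"
  shows
    "(residual_map x y \<theta>b \<in> minimizers quadratic_loss \<and>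
      full_row_rank (jacobian (residual_map x y) (at \<theta>b)) \<longrightarrow>
        (\<exists>r>0. \<exists>T>0. \<forall>t\<ge>T. \<forall>\<theta>\<^sub>0\<in>ball \<theta>b r. \<exists>\<theta>s.
           linearly_converges (lpa quadratic_loss (residual_map x y) t \<theta>\<^sub>0) \<theta>s \<and>
           \<theta>s \<in> minimizers (\<lambda>\<theta>. quadratic_loss (residual_map x y \<theta>)) \<and>
           residual_map x y \<theta>s = 0)) \<and>
     (residual_map x y \<theta>b \<in> minimizers absolute_loss \<and>
      full_row_rank (jacobian (residual_map x y) (at \<theta>b)) \<longrightarrow>
        (\<forall>t>0. \<exists>r>0. \<forall>\<theta>\<^sub>0\<in>ball \<theta>b r. \<exists>\<theta>s.
           quadratically_converges (lpa absolute_loss (residual_map x y) t \<theta>\<^sub>0) \<theta>s \<and>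
           \<theta>s \<in> minimizers (\<lambda>\<theta>. absolute_loss (residual_map x y \<theta>)) \<and>
           residual_map x y \<theta>s = 0)) \<and>
     (margin_map x y \<theta>b \<in> minimizers hinge_loss \<and>
      full_row_rank (jacobian (margin_map x y) (at \<theta>b)) \<longrightarrow>
        (\<forall>t>0. \<exists>r>0. \<forall>\<theta>\<^sub>0\<in>ball \<theta>b r. \<exists>\<theta>s.
           quadratically_converges (lpa hinge_loss (margin_map x y) t \<theta>\<^sub>0) \<theta>s \<and>
           \<theta>s \<in> minimizers (\<lambda>\<theta>. hinge_loss (margin_map x y \<theta>)) \<and>
           (\<forall>i. margin_map x y \<theta>s $ i \<ge> 1)))"
proof (intro conjI impI allI)
  assume A: "residual_map x y \<theta>b \<in> minimizers quadratic_loss \<and>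
    full_row_rank (jacobian (residual_map x y) (at \<theta>b))"
  \<comment> \<open>The vector 0 has loss 0, so a minimizer has loss 0 as well.\<close>
  then have b: "residual_map x y \<theta>b = 0"
    using minimizers_le[of _ quadratic_loss 0] quadratic_loss_nonneg quadratic_loss_eq_0_iff
    by (metis order_antisym)
  obtain R K M \<kappa> where "regular_near (residual_map x y) \<theta>b R K M \<kappa>"
    using A regular_near_residual_map by blast
  then interpret regular_inclusion "residual_map x y" \<theta>b R K M \<kappa> quadratic_loss "{0}"
    by unfold_locales
      (simp_all add: b quadratic_loss_nonneg quadratic_loss_eq_0_iff continuous_on_quadratic_loss)
  have "\<exists>r>0. \<exists>T>0. \<forall>t\<ge>T. \<forall>\<theta>\<^sub>0\<in>ball \<theta>b r. \<exists>\<theta>s.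
      linearly_converges (lpa quadratic_loss (residual_map x y) t \<theta>\<^sub>0) \<theta>s \<and>
      \<theta>s \<in> minimizers (\<lambda>\<theta>. quadratic_loss (residual_map x y \<theta>)) \<and> residual_map x y \<theta>s \<in> {0}"
    \<comment> \<open>The growth constant is the number of samples, which cancels the averaging
      factor in the loss.\<close>
    by (rule lpa_linearly_converges[where \<alpha> = "real CARD('m)"]) (simp_all only: infdist_quadratic_loss of_nat_0_less_iff zero_less_card_finite)
  then show "\<exists>r>0. \<exists>T>0. \<forall>t\<ge>T. \<forall>\<theta>\<^sub>0\<in>ball \<theta>b r. \<exists>\<theta>s.
      linearly_converges (lpa quadratic_loss (residual_map x y) t \<theta>\<^sub>0) \<theta>s \<and>
      \<theta>s \<in> minimizers (\<lambda>\<theta>. quadratic_loss (residual_map x y \<theta>)) \<and> residual_map x y \<theta>s = 0"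
    by simp
next
  fix t :: real assume "t > 0"
  assume A: "residual_map x y \<theta>b \<in> minimizers absolute_loss \<and>
    full_row_rank (jacobian (residual_map x y) (at \<theta>b))"
  then have b: "residual_map x y \<theta>b = 0"
    using minimizers_le[of _ absolute_loss 0] absolute_loss_nonneg absolute_loss_eq_0_iff
    by (metis order_antisym)
  obtain R K M \<kappa> where "regular_near (residual_map x y) \<theta>b R K M \<kappa>"
    using A regular_near_residual_map by blast
  then interpret regular_inclusion "residual_map x y" \<theta>b R K M \<kappa> absolute_loss "{0}"
    by unfold_locales
      (simp_all add: b absolute_loss_nonneg absolute_loss_eq_0_iff continuous_on_absolute_loss)
  have "\<exists>r>0. \<forall>\<theta>\<^sub>0\<in>ball \<theta>b r. \<exists>\<theta>s.
      quadratically_converges (lpa absolute_loss (residual_map x y) t \<theta>\<^sub>0) \<theta>s \<and>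
      \<theta>s \<in> minimizers (\<lambda>\<theta>. absolute_loss (residual_map x y \<theta>)) \<and> residual_map x y \<theta>s \<in> {0}"
    by (rule lpa_quadratically_converges[where \<alpha> = "real CARD('m)"])
      (simp_all only: infdist_absolute_loss \<open>t > 0\<close> of_nat_0_less_iff zero_less_card_finite)
  then show "\<exists>r>0. \<forall>\<theta>\<^sub>0\<in>ball \<theta>b r. \<exists>\<theta>s.
      quadratically_converges (lpa absolute_loss (residual_map x y) t \<theta>\<^sub>0) \<theta>s \<and>
      \<theta>s \<in> minimizers (\<lambda>\<theta>. absolute_loss (residual_map x y \<theta>)) \<and> residual_map x y \<theta>s = 0"
    by simp
next
  fix t :: real assume "t > 0"
  assume A: "margin_map x y \<theta>b \<in> minimizers hinge_loss \<and>
    full_row_rank (jacobian (margin_map x y) (at \<theta>b))"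
  let ?C = "{z :: real ^ 'm. \<forall>i. z $ i \<ge> 1}"
  \<comment> \<open>The all-ones vector has hinge loss 0, so the minimum is 0 and is attained
    exactly where all components are at least 1.\<close>
  have "hinge_loss (margin_map x y \<theta>b) \<le> hinge_loss ((\<chi> i. 1) :: real ^ 'm)"
    by (rule minimizers_le[OF conjunct1[OF A]])
  also have "hinge_loss ((\<chi> i. 1) :: real ^ 'm) = 0"
    by (simp add: hinge_loss_eq_0_iff)
  finally have b: "\<forall>i. margin_map x y \<theta>b $ i \<ge> 1"
    using hinge_loss_nonneg[of "margin_map x y \<theta>b"] hinge_loss_eq_0_iff[of "margin_map x y \<theta>b"] by simp
  have "closed ?C"
    by (intro closed_Collect_all closed_Collect_le continuous_intros)
  obtain R K M \<kappa> where "regular_near (margin_map x y) \<theta>b R K M \<kappa>"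
    using A regular_near_margin_map by blast
  then interpret regular_inclusion "margin_map x y" \<theta>b R K M \<kappa> hinge_loss ?C
    by unfold_locales
      (simp_all add: b \<open>closed ?C\<close> hinge_loss_nonneg hinge_loss_eq_0_iff continuous_on_hinge_loss)
  have "\<exists>r>0. \<forall>\<theta>\<^sub>0\<in>ball \<theta>b r. \<exists>\<theta>s.
      quadratically_converges (lpa hinge_loss (margin_map x y) t \<theta>\<^sub>0) \<theta>s \<and>
      \<theta>s \<in> minimizers (\<lambda>\<theta>. hinge_loss (margin_map x y \<theta>)) \<and> margin_map x y \<theta>s \<in> ?C"
    by (rule lpa_quadratically_converges[where \<alpha> = "real CARD('m)"])
      (simp_all only: infdist_hinge_loss \<open>t > 0\<close> of_nat_0_less_iff zero_less_card_finite)
  then show "\<exists>r>0. \<forall>\<theta>\<^sub>0\<in>ball \<theta>b r. \<exists>\<theta>s.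
      quadratically_converges (lpa hinge_loss (margin_map x y) t \<theta>\<^sub>0) \<theta>s \<and>
      \<theta>s \<in> minimizers (\<lambda>\<theta>. hinge_loss (margin_map x y \<theta>)) \<and> (\<forall>i. margin_map x y \<theta>s $ i \<ge> 1)"
    by simp
qed

end
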